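(* Let $W_\alpha$ be a subnormal unilateral weighted shift on $\ell^2(\mathbb{Z}_+)$ with (bounded, positive) weight sequence $\alpha=\{\alpha_n\}_{n=0}^\infty$. Then there exists no nonzero finite rank operator $F$ on $\ell^2(\mathbb{Z}_+)$, other than operators of the form $Fx=c\,\langle x,e_0\rangle e_1$ with $c$ a scalar (i.e. perturbations of the zeroth weight only), such that $W_\alpha+F$ is a subnormal weighted shift. Concretely: if $\alpha'=\{\alpha'_n\}_{n=0}^\infty$ is a sequence of positive numbers with $\alpha'_0=\alpha_0$, with $\alpha'_n=\alpha_n$ for all but finitely many $n$, and with $\alpha'\neq\alpha$, then $W_{\alpha'}$ is not subnormal.
   Context: $\{e_n\}_{n=0}^\infty$ is the canonical orthonormal basis of $\ell^2(\mathbb{Z}_+)$. For a bounded sequence of positive numbers $\alpha=\{\alpha_n\}_{n\ge0}$ (weights), the unilateral weighted shift $W_\alpha$ is the bounded operator on $\ell^2(\mathbb{Z}_+)$ with $W_\alpha e_n=\alpha_n e_{n+1}$ for all $n\ge 0$. "Weighted shift" always means an operator of this form with respect to this basis. An operator $T$ on a Hilbert space $\mathcal H$ is subnormal if it is the restriction to $\mathcal H$ of a normal operator $N$ on some Hilbert space $\mathcal K\supseteq\mathcal H$ leaving $\mathcal H$ invariant. *)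

theory Defs
  imports "HOL-Analysis.Analysis"
begin

section \<open>Complex Hilbert spaces\<close>

text \<open>
  The inner product is linear in the first argument, so that the operator with value
  \<open>c \<langle>x, a\<rangle> b\<close> at \<open>x\<close> is linear. Positive definiteness is part of \<open>cinner_self\<close>.
\<close>

class complex_hilbert = banach +
  fixes scaleC :: "complex \<Rightarrow> 'a \<Rightarrow> 'a" (infixr \<open>*\<^sub>C\<close> 75)
    and cinner :: "'a \<Rightarrow> 'a \<Rightarrow> complex"
  assumes scaleC_add_right: "a *\<^sub>C (x + y) = a *\<^sub>C x + a *\<^sub>C y"
    and scaleC_add_left: "(a + b) *\<^sub>C x = a *\<^sub>C x + b *\<^sub>C x"
    and scaleC_scaleC: "a *\<^sub>C b *\<^sub>C x = (a * b) *\<^sub>C x"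
    and scaleR_scaleC: "r *\<^sub>R x = complex_of_real r *\<^sub>C x"
    and cinner_commute: "cinner x y = cnj (cinner y x)"
    and cinner_add_left: "cinner (x + y) z = cinner x z + cinner y z"
    and cinner_scaleC_left: "cinner (a *\<^sub>C x) y = a * cinner x y"
    and cinner_self: "cinner x x = complex_of_real ((norm x)\<^sup>2)"

global_interpretation complex_hilbert: vector_space "scaleC :: complex \<Rightarrow> 'a \<Rightarrow> 'a::complex_hilbert"
  defines cspan = complex_hilbert.span
proof
  fix x :: 'a
  show "1 *\<^sub>C x = x"
    using scaleR_scaleC[of 1 x] by simp
qed (simp_all add: scaleC_add_right scaleC_add_left scaleC_scaleC)

definition bounded_clinear :: "('a::complex_hilbert \<Rightarrow> 'b::complex_hilbert) \<Rightarrow> bool" where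
  "bounded_clinear T \<longleftrightarrow> bounded_linear T \<and> (\<forall>c x. T (c *\<^sub>C x) = c *\<^sub>C T x)"

definition finite_rank :: "('a::complex_hilbert \<Rightarrow> 'b::complex_hilbert) \<Rightarrow> bool" where
  "finite_rank T \<longleftrightarrow> bounded_clinear T \<and> (\<exists>B. finite B \<and> range T \<subseteq> cspan B)"

definition is_adjoint :: "('a::complex_hilbert \<Rightarrow> 'b::complex_hilbert) \<Rightarrow> ('b \<Rightarrow> 'a) \<Rightarrow> bool" where
  "is_adjoint T S \<longleftrightarrow> (\<forall>x y. cinner (T x) y = cinner x (S y))"

definition normal_operator :: "('a::complex_hilbert \<Rightarrow> 'a) \<Rightarrow> bool" where
  "normal_operator N \<longleftrightarrow>
     bounded_clinear N \<and> (\<exists>M. bounded_clinear M \<and> is_adjoint N M \<and> N \<circ> M = M \<circ> N)"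

text \<open>
  The inclusion of \<open>H\<close> in \<open>K\<close> is given by an isometric embedding \<open>V\<close>; the equation
  \<open>N (V x) = V (T x)\<close> says both that \<open>V ` H\<close> is invariant under \<open>N\<close> and that the
  restriction of \<open>N\<close> to it is \<open>T\<close>. As HOL has no quantification over types, the space \<open>K\<close>
  in which the normal extension lives is a type parameter: \<open>T\<close> is subnormal iff
  \<open>subnormal_in TYPE('k) T\<close> holds for some \<open>'k\<close>. Hence in a theorem a type variable used only
  in a hypothesis \<open>subnormal_in TYPE('k) T\<close> expresses subnormality of \<open>T\<close>, and one used only
  in a negative conclusion \<open>\<not> subnormal_in TYPE('l) T\<close> expresses that \<open>T\<close> is not subnormal.
\<close>

definition subnormal_in :: "'k::complex_hilbert itself \<Rightarrow> ('h::complex_hilbert \<Rightarrow> 'h) \<Rightarrow> bool" where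
  "subnormal_in _ T \<longleftrightarrow> bounded_clinear T \<and>
     (\<exists>(V :: 'h \<Rightarrow> 'k) N.
        bounded_clinear V \<and> (\<forall>x y. cinner (V x) (V y) = cinner x y) \<and>
        normal_operator N \<and> (\<forall>x. N (V x) = V (T x)))"


section \<open>The Hilbert space of square-summable sequences\<close>

typedef ell2 = "{x :: nat \<Rightarrow> complex. summable (\<lambda>n. (cmod (x n))\<^sup>2)}"
  morphisms ell2_coeff Abs_ell2
  by (rule exI[of _ "\<lambda>_. 0"]) simp

setup_lifting type_definition_ell2

lemma square_summable_add:
  fixes x y :: "nat \<Rightarrow> complex"
  assumes "summable (\<lambda>n. (cmod (x n))\<^sup>2)" "summable (\<lambda>n. (cmod (y n))\<^sup>2)"
  shows "summable (\<lambda>n. (cmod (x n + y n))\<^sup>2)"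
proof (rule summable_comparison_test')
  show "summable (\<lambda>n. 2 * (cmod (x n))\<^sup>2 + 2 * (cmod (y n))\<^sup>2)"
    using assms by (intro summable_add summable_mult)
  fix n :: nat
  have "(cmod (x n + y n))\<^sup>2 \<le> (cmod (x n) + cmod (y n))\<^sup>2"
    by (simp add: norm_triangle_ineq power_mono)
  also have "\<dots> \<le> 2 * (cmod (x n))\<^sup>2 + 2 * (cmod (y n))\<^sup>2"
    using sum_squares_bound[of "cmod (x n)" "cmod (y n)"] by (simp add: power2_sum)
  finally show "norm ((cmod (x n + y n))\<^sup>2) \<le> 2 * (cmod (x n))\<^sup>2 + 2 * (cmod (y n))\<^sup>2"
    by simp
qed

lemma square_summable_scale:
  fixes x :: "nat \<Rightarrow> complex"
  assumes "summable (\<lambda>n. (cmod (x n))\<^sup>2)"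
  shows "summable (\<lambda>n. (cmod (c * x n))\<^sup>2)"
  using summable_mult[OF assms, of "(cmod c)\<^sup>2"] by (simp add: norm_mult power_mult_distrib)

lemma square_summable_prod:
  fixes x y :: "nat \<Rightarrow> complex"
  assumes "summable (\<lambda>n. (cmod (x n))\<^sup>2)" "summable (\<lambda>n. (cmod (y n))\<^sup>2)"
  shows "summable (\<lambda>n. x n * cnj (y n))"
proof (rule summable_comparison_test')
  show "summable (\<lambda>n. (cmod (x n))\<^sup>2 + (cmod (y n))\<^sup>2)"
    using assms by (rule summable_add)
  fix n :: nat
  have "2 * (cmod (x n) * cmod (y n)) \<le> (cmod (x n))\<^sup>2 + (cmod (y n))\<^sup>2"
    using sum_squares_bound[of "cmod (x n)" "cmod (y n)"] by (simp add: mult.assoc)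
  moreover have "0 \<le> cmod (x n) * cmod (y n)" by simp
  ultimately have "cmod (x n) * cmod (y n) \<le> (cmod (x n))\<^sup>2 + (cmod (y n))\<^sup>2" by linarith
  then show "norm (x n * cnj (y n)) \<le> (cmod (x n))\<^sup>2 + (cmod (y n))\<^sup>2"
    by (simp add: norm_mult)
qed

lemma summable_coeff: "summable (\<lambda>n. (cmod (ell2_coeff x n))\<^sup>2)"
  using ell2_coeff[of x] by simp

lemma summable_coeff_prod: "summable (\<lambda>n. ell2_coeff x n * cnj (ell2_coeff y n))"
  by (rule square_summable_prod[OF summable_coeff summable_coeff])

instantiation ell2 :: real_vector
begin
lift_definition zero_ell2 :: ell2 is "\<lambda>_. 0" by simp
lift_definition plus_ell2 :: "ell2 \<Rightarrow> ell2 \<Rightarrow> ell2" is "\<lambda>x y n. x n + y n"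
  by (rule square_summable_add)
lift_definition uminus_ell2 :: "ell2 \<Rightarrow> ell2" is "\<lambda>x n. - x n" by simp
lift_definition minus_ell2 :: "ell2 \<Rightarrow> ell2 \<Rightarrow> ell2" is "\<lambda>x y n. x n - y n"
  subgoal for x y using square_summable_add[of x "\<lambda>n. - y n"] by simp done
lift_definition scaleR_ell2 :: "real \<Rightarrow> ell2 \<Rightarrow> ell2" is "\<lambda>r x n. complex_of_real r * x n"
  by (rule square_summable_scale)
instance
  by standard (transfer; auto simp: algebra_simps)+
end

instantiation ell2 :: real_normed_vector
begin
definition norm_ell2 :: "ell2 \<Rightarrow> real" where
  "norm_ell2 x = sqrt (\<Sum>n. (cmod (ell2_coeff x n))\<^sup>2)"
definition dist_ell2 :: "ell2 \<Rightarrow> ell2 \<Rightarrow> real" where "dist_ell2 x y = norm (x - y)"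
definition sgn_ell2 :: "ell2 \<Rightarrow> ell2" where "sgn_ell2 x = x /\<^sub>R norm x"
definition uniformity_ell2 :: "(ell2 \<times> ell2) filter" where
  "uniformity_ell2 = (INF e\<in>{0<..}. principal {(x :: ell2, y). dist x y < e})"
definition open_ell2 :: "ell2 set \<Rightarrow> bool" where
  "open_ell2 U = (\<forall>x\<in>U. \<forall>\<^sub>F (x', y) in uniformity. x' = x \<longrightarrow> y \<in> U)"

lemma L2_set_coeff_le_norm: "L2_set (\<lambda>n. cmod (ell2_coeff x n)) {..<m} \<le> norm x"
  unfolding L2_set_def norm_ell2_def
  by (intro real_sqrt_le_mono sum_le_suminf) (auto simp: summable_coeff)

lemma norm_le_of_L2_set_le:
  assumes "\<And>m. L2_set (\<lambda>n. cmod (ell2_coeff x n)) {..<m} \<le> b"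
  shows "norm x \<le> b"
proof -
  have b: "0 \<le> b" using assms[of 0] by simp
  have "(\<Sum>n. (cmod (ell2_coeff x n))\<^sup>2) \<le> b\<^sup>2"
  proof (rule suminf_le_const[OF summable_coeff])
    fix m
    show "(\<Sum>n<m. (cmod (ell2_coeff x n))\<^sup>2) \<le> b\<^sup>2"
      using assms[of m] unfolding L2_set_def by (rule sqrt_le_D)
  qed
  then show ?thesis unfolding norm_ell2_def by (rule real_le_lsqrt[OF b])
qed

instance
proof
  fix x y :: ell2 and r :: real
  have "(\<Sum>n. (cmod (ell2_coeff x n))\<^sup>2) = 0 \<longleftrightarrow> (\<forall>n. (cmod (ell2_coeff x n))\<^sup>2 = 0)"
    by (rule suminf_eq_zero_iff[OF summable_coeff]) simp
  then show "norm x = 0 \<longleftrightarrow> x = 0"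
    unfolding norm_ell2_def
    by (simp add: ell2_coeff_inject[symmetric] zero_ell2.rep_eq fun_eq_iff)
  show "norm (x + y) \<le> norm x + norm y"
  proof (rule norm_le_of_L2_set_le)
    fix m
    have "L2_set (\<lambda>n. cmod (ell2_coeff (x + y) n)) {..<m}
        \<le> L2_set (\<lambda>n. cmod (ell2_coeff x n) + cmod (ell2_coeff y n)) {..<m}"
      by (rule L2_set_mono) (auto simp: plus_ell2.rep_eq norm_triangle_ineq)
    also have "\<dots> \<le> L2_set (\<lambda>n. cmod (ell2_coeff x n)) {..<m} + L2_set (\<lambda>n. cmod (ell2_coeff y n)) {..<m}"
      by (rule L2_set_triangle_ineq)
    also have "\<dots> \<le> norm x + norm y"
      by (intro add_mono L2_set_coeff_le_norm)
    finally show "L2_set (\<lambda>n. cmod (ell2_coeff (x + y) n)) {..<m} \<le> norm x + norm y" .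
  qed
  show "norm (r *\<^sub>R x) = \<bar>r\<bar> * norm x"
    unfolding norm_ell2_def
    by (simp add: scaleR_ell2.rep_eq norm_mult power_mult_distrib suminf_mult[OF summable_coeff]
        real_sqrt_mult)
qed (simp_all add: dist_ell2_def sgn_ell2_def uniformity_ell2_def open_ell2_def)
end

lemma norm_coeff_le: "cmod (ell2_coeff x n) \<le> norm x"
proof -
  have "cmod (ell2_coeff x n) \<le> L2_set (\<lambda>n. cmod (ell2_coeff x n)) {..<Suc n}"
    by (rule member_le_L2_set) auto
  also have "\<dots> \<le> norm x" by (rule L2_set_coeff_le_norm)
  finally show ?thesis .
qed

instance ell2 :: banach
proof
  fix X :: "nat \<Rightarrow> ell2"
  assume C: "Cauchy X"
  have "Cauchy (\<lambda>i. ell2_coeff (X i) n)" for n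
  proof (rule CauchyI)
    fix e :: real assume "0 < e"
    from CauchyD[OF C this] obtain M where M: "\<forall>i\<ge>M. \<forall>j\<ge>M. norm (X i - X j) < e" by blast
    have "norm (ell2_coeff (X i) n - ell2_coeff (X j) n) < e" if "i \<ge> M" "j \<ge> M" for i j
      using M that norm_coeff_le[of "X i - X j" n] by (fastforce simp: minus_ell2.rep_eq)
    then show "\<exists>M. \<forall>m\<ge>M. \<forall>k\<ge>M. norm (ell2_coeff (X m) n - ell2_coeff (X k) n) < e" by blast
  qed
  then have "\<exists>l. (\<lambda>i. ell2_coeff (X i) n) \<longlonglongrightarrow> l" for n
    by (simp add: Cauchy_convergent_iff convergent_def)
  then obtain l where l: "\<And>n. (\<lambda>i. ell2_coeff (X i) n) \<longlonglongrightarrow> l n" by metis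
  have lim: "(\<lambda>j. L2_set (\<lambda>n. cmod (ell2_coeff (X i) n - ell2_coeff (X j) n)) {..<m})
      \<longlonglongrightarrow> L2_set (\<lambda>n. cmod (ell2_coeff (X i) n - l n)) {..<m}" for i m
    unfolding L2_set_def by (intro tendsto_intros l)
  have key: "\<exists>M. \<forall>i\<ge>M. \<forall>m. L2_set (\<lambda>n. cmod (ell2_coeff (X i) n - l n)) {..<m} \<le> e" if "e > 0" for e
  proof -
    from CauchyD[OF C that] obtain M where M: "\<forall>i\<ge>M. \<forall>j\<ge>M. norm (X i - X j) < e" by blast
    have "L2_set (\<lambda>n. cmod (ell2_coeff (X i) n - l n)) {..<m} \<le> e" if "i \<ge> M" for i m
    proof (rule LIMSEQ_le_const2[OF lim], intro exI allI impI)
      fix j assume "M \<le> j"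
      with M that have "norm (X i - X j) \<le> e" by fastforce
      with L2_set_coeff_le_norm[of "X i - X j" m]
      show "L2_set (\<lambda>n. cmod (ell2_coeff (X i) n - ell2_coeff (X j) n)) {..<m} \<le> e"
        by (simp add: minus_ell2.rep_eq)
    qed
    then show ?thesis by blast
  qed
  have "\<exists>i. summable (\<lambda>n. (cmod (ell2_coeff (X i) n - l n))\<^sup>2)"
  proof -
    from key[of 1] obtain M where M: "\<And>m. L2_set (\<lambda>n. cmod (ell2_coeff (X M) n - l n)) {..<m} \<le> 1"
      by auto
    have "summable (\<lambda>n. (cmod (ell2_coeff (X M) n - l n))\<^sup>2)"
    proof (rule summableI_nonneg_bounded)
      fix m
      show "(\<Sum>n<m. (cmod (ell2_coeff (X M) n - l n))\<^sup>2) \<le> 1\<^sup>2"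
        using M[of m] unfolding L2_set_def by (rule sqrt_le_D)
    qed simp
    then show ?thesis ..
  qed
  then obtain i where i: "summable (\<lambda>n. (cmod (ell2_coeff (X i) n - l n))\<^sup>2)" ..
  have "summable (\<lambda>n. (cmod (l n))\<^sup>2)"
    using square_summable_add[OF summable_coeff[of "X i"], of "\<lambda>n. l n - ell2_coeff (X i) n"] i
    by (simp add: norm_minus_commute)
  then have L: "ell2_coeff (Abs_ell2 l) = l" by (simp add: Abs_ell2_inverse)
  have "X \<longlonglongrightarrow> Abs_ell2 l"
  proof (rule LIMSEQ_I)
    fix e :: real assume "0 < e"
    then obtain M where M: "\<forall>i\<ge>M. \<forall>m. L2_set (\<lambda>n. cmod (ell2_coeff (X i) n - l n)) {..<m} \<le> e / 2"
      using key[of "e / 2"] by auto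
    have "norm (X i - Abs_ell2 l) < e" if "i \<ge> M" for i
    proof -
      have "norm (X i - Abs_ell2 l) \<le> e / 2"
        by (rule norm_le_of_L2_set_le) (use M that in \<open>simp add: minus_ell2.rep_eq L\<close>)
      with \<open>0 < e\<close> show ?thesis by simp
    qed
    then show "\<exists>no. \<forall>n\<ge>no. norm (X n - Abs_ell2 l) < e" by blast
  qed
  then show "convergent X" by (auto simp: convergent_def)
qed

instantiation ell2 :: complex_hilbert
begin
lift_definition scaleC_ell2 :: "complex \<Rightarrow> ell2 \<Rightarrow> ell2" is "\<lambda>c x n. c * x n"
  by (rule square_summable_scale)
definition cinner_ell2 :: "ell2 \<Rightarrow> ell2 \<Rightarrow> complex" where
  "cinner_ell2 x y = (\<Sum>n. ell2_coeff x n * cnj (ell2_coeff y n))"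
instance
proof
  fix a b :: complex and r :: real and x y z :: ell2
  show "a *\<^sub>C (x + y) = a *\<^sub>C x + a *\<^sub>C y" by transfer (auto simp: algebra_simps)
  show "(a + b) *\<^sub>C x = a *\<^sub>C x + b *\<^sub>C x" by transfer (auto simp: algebra_simps)
  show "a *\<^sub>C b *\<^sub>C x = (a * b) *\<^sub>C x" by transfer (auto simp: algebra_simps)
  show "r *\<^sub>R x = complex_of_real r *\<^sub>C x" by transfer simp
  have "cnj (\<Sum>n. ell2_coeff y n * cnj (ell2_coeff x n)) = (\<Sum>n. cnj (ell2_coeff y n * cnj (ell2_coeff x n)))"
    by (rule bounded_linear.suminf[OF bounded_linear_cnj summable_coeff_prod])
  then show "cinner x y = cnj (cinner y x)"
    unfolding cinner_ell2_def by (simp add: mult.commute)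
  show "cinner (x + y) z = cinner x z + cinner y z"
    unfolding cinner_ell2_def
    by (simp add: plus_ell2.rep_eq distrib_right suminf_add[OF summable_coeff_prod summable_coeff_prod])
  show "cinner (a *\<^sub>C x) y = a * cinner x y"
    unfolding cinner_ell2_def
    by (simp add: scaleC_ell2.rep_eq mult.assoc suminf_mult[OF summable_coeff_prod])
  have "(norm x)\<^sup>2 = (\<Sum>n. (cmod (ell2_coeff x n))\<^sup>2)"
    unfolding norm_ell2_def by (simp add: suminf_nonneg summable_coeff)
  then show "cinner x x = complex_of_real ((norm x)\<^sup>2)"
    unfolding cinner_ell2_def
    by (simp add: bounded_linear.suminf[OF bounded_linear_of_real summable_coeff]
        complex_norm_square[symmetric])
qed
end

lift_definition basis_vec :: "nat \<Rightarrow> ell2" is "\<lambda>n k. if k = n then 1 else 0"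
  subgoal for n by (rule summable_finite[of "{n}"]) auto done


section \<open>Weighted shifts\<close>

text \<open>
  The underlying sequence is square-summable for bounded weights; no meaning is attached to
  \<open>weighted_shift \<alpha>\<close> for unbounded \<open>\<alpha>\<close>. That this is the operator determined by its values
  on the basis is \<open>weighted_shift_unique\<close> below.
\<close>

definition weighted_shift :: "(nat \<Rightarrow> real) \<Rightarrow> ell2 \<Rightarrow> ell2" where
  "weighted_shift \<alpha> x =
     Abs_ell2 (\<lambda>n. case n of 0 \<Rightarrow> 0 | Suc m \<Rightarrow> complex_of_real (\<alpha> m) * ell2_coeff x m)"

lemma weighted_shift_square_summable:
  assumes "bounded (range \<alpha>)"
  shows "summable (\<lambda>n. (cmod (case n of 0 \<Rightarrow> 0 | Suc m \<Rightarrow> complex_of_real (\<alpha> m) * ell2_coeff x m))\<^sup>2)"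
proof -
  obtain b where b: "\<And>n. \<bar>\<alpha> n\<bar> \<le> b" using assms by (auto simp: bounded_iff)
  have "summable (\<lambda>n. (cmod (complex_of_real (\<alpha> n) * ell2_coeff x n))\<^sup>2)"
  proof (rule summable_comparison_test')
    show "summable (\<lambda>n. b\<^sup>2 * (cmod (ell2_coeff x n))\<^sup>2)" by (rule summable_mult[OF summable_coeff])
    fix n :: nat
    have "\<bar>\<alpha> n\<bar>\<^sup>2 \<le> b\<^sup>2" by (rule power_mono[OF b]) simp
    then show "norm ((cmod (complex_of_real (\<alpha> n) * ell2_coeff x n))\<^sup>2) \<le> b\<^sup>2 * (cmod (ell2_coeff x n))\<^sup>2"
      by (simp add: norm_mult power_mult_distrib mult_right_mono)
  qed
  then show ?thesis by (subst summable_Suc_iff[symmetric]) simp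
qed

lemma coeff_weighted_shift:
  assumes "bounded (range \<alpha>)"
  shows "ell2_coeff (weighted_shift \<alpha> x) n =
    (case n of 0 \<Rightarrow> 0 | Suc m \<Rightarrow> complex_of_real (\<alpha> m) * ell2_coeff x m)"
  unfolding weighted_shift_def
  by (subst Abs_ell2_inverse) (simp_all add: weighted_shift_square_summable[OF assms])

lemma bounded_clinear_weighted_shift:
  assumes "bounded (range \<alpha>)"
  shows "bounded_clinear (weighted_shift \<alpha>)"
  unfolding bounded_clinear_def
proof (intro conjI allI)
  obtain b where b: "\<And>n. \<bar>\<alpha> n\<bar> \<le> b" using assms by (auto simp: bounded_iff)
  have b0: "0 \<le> b" using b[of 0] by linarith
  show "weighted_shift \<alpha> (c *\<^sub>C x) = c *\<^sub>C weighted_shift \<alpha> x" for c x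
    by (simp add: ell2_coeff_inject[symmetric] fun_eq_iff coeff_weighted_shift[OF assms]
        scaleC_ell2.rep_eq split: nat.split)
  show "bounded_linear (weighted_shift \<alpha>)"
  proof (rule bounded_linear_intro)
    fix x y :: ell2 and r :: real
    show "weighted_shift \<alpha> (x + y) = weighted_shift \<alpha> x + weighted_shift \<alpha> y"
      by (simp add: ell2_coeff_inject[symmetric] fun_eq_iff coeff_weighted_shift[OF assms]
          plus_ell2.rep_eq algebra_simps split: nat.split)
    show "weighted_shift \<alpha> (r *\<^sub>R x) = r *\<^sub>R weighted_shift \<alpha> x"
      by (simp add: ell2_coeff_inject[symmetric] fun_eq_iff coeff_weighted_shift[OF assms]
          scaleR_ell2.rep_eq split: nat.split)
    show "norm (weighted_shift \<alpha> x) \<le> norm x * b"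
    proof (rule norm_le_of_L2_set_le)
      fix m
      have "(\<Sum>n<m. (cmod (ell2_coeff (weighted_shift \<alpha> x) n))\<^sup>2)
          \<le> (\<Sum>n<Suc m. (cmod (ell2_coeff (weighted_shift \<alpha> x) n))\<^sup>2)" by simp
      also have "\<dots> = (\<Sum>n<m. (cmod (complex_of_real (\<alpha> n) * ell2_coeff x n))\<^sup>2)"
        by (subst sum.lessThan_Suc_shift) (simp add: coeff_weighted_shift[OF assms])
      also have "\<dots> \<le> (\<Sum>n<m. (b * cmod (ell2_coeff x n))\<^sup>2)"
        by (intro sum_mono power_mono) (auto simp: norm_mult b intro: mult_right_mono)
      finally have "L2_set (\<lambda>n. cmod (ell2_coeff (weighted_shift \<alpha> x) n)) {..<m}
          \<le> L2_set (\<lambda>n. b * cmod (ell2_coeff x n)) {..<m}"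
        unfolding L2_set_def by (rule real_sqrt_le_mono)
      also have "\<dots> = b * L2_set (\<lambda>n. cmod (ell2_coeff x n)) {..<m}"
        by (rule L2_set_right_distrib[OF b0, symmetric])
      also have "\<dots> \<le> b * norm x"
        by (rule mult_left_mono[OF L2_set_coeff_le_norm b0])
      finally show "L2_set (\<lambda>n. cmod (ell2_coeff (weighted_shift \<alpha> x) n)) {..<m} \<le> norm x * b"
        by (simp add: mult.commute)
    qed
  qed
qed

lemma weighted_shift_basis_vec:
  assumes "bounded (range \<alpha>)"
  shows "weighted_shift \<alpha> (basis_vec n) = complex_of_real (\<alpha> n) *\<^sub>C basis_vec (Suc n)"
  by (auto simp: ell2_coeff_inject[symmetric] fun_eq_iff coeff_weighted_shift[OF assms]
      scaleC_ell2.rep_eq basis_vec.rep_eq split: nat.split)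

lemma coeff_sum: "ell2_coeff (sum f A) n = (\<Sum>k\<in>A. ell2_coeff (f k) n)"
  by (induction A rule: infinite_finite_induct) (simp_all add: zero_ell2.rep_eq plus_ell2.rep_eq)

lemma basis_vec_sums: "(\<lambda>k. ell2_coeff x k *\<^sub>C basis_vec k) sums x"
proof -
  let ?g = "\<lambda>n. (cmod (ell2_coeff x n))\<^sup>2"
  have coeff_tail: "ell2_coeff (x - (\<Sum>k<m. ell2_coeff x k *\<^sub>C basis_vec k)) n = (if n < m then 0 else ell2_coeff x n)"
    for m n
  proof -
    have "(\<Sum>k<m. ell2_coeff x k * (if n = k then 1 else 0)) = (\<Sum>k<m. if n = k then ell2_coeff x k else 0)"
      by (rule sum.cong) auto
    then show ?thesis
      by (simp add: minus_ell2.rep_eq coeff_sum scaleC_ell2.rep_eq basis_vec.rep_eq sum.delta')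
  qed
  have "(norm (x - (\<Sum>k<m. ell2_coeff x k *\<^sub>C basis_vec k)))\<^sup>2 = suminf ?g - sum ?g {..<m}" for m
  proof -
    let ?h = "\<lambda>n. (cmod (ell2_coeff (x - (\<Sum>k<m. ell2_coeff x k *\<^sub>C basis_vec k)) n))\<^sup>2"
    have "(norm (x - (\<Sum>k<m. ell2_coeff x k *\<^sub>C basis_vec k)))\<^sup>2 = suminf ?h"
      unfolding norm_ell2_def by (intro real_sqrt_pow2 suminf_nonneg summable_coeff) simp
    also have "\<dots> = (\<Sum>n. ?h (n + m)) + sum ?h {..<m}"
      by (rule suminf_split_initial_segment[OF summable_coeff])
    also have "\<dots> = (\<Sum>n. ?g (n + m))" by (simp add: coeff_tail)
    also have "\<dots> = suminf ?g - sum ?g {..<m}"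
      by (rule suminf_minus_initial_segment[OF summable_coeff])
    finally show ?thesis .
  qed
  moreover have "(\<lambda>m. suminf ?g - sum ?g {..<m}) \<longlonglongrightarrow> suminf ?g - suminf ?g"
    by (intro tendsto_intros summable_LIMSEQ summable_coeff)
  ultimately have "(\<lambda>m. (norm (x - (\<Sum>k<m. ell2_coeff x k *\<^sub>C basis_vec k)))\<^sup>2) \<longlonglongrightarrow> 0" by simp
  then have "(\<lambda>m. sqrt ((norm (x - (\<Sum>k<m. ell2_coeff x k *\<^sub>C basis_vec k)))\<^sup>2)) \<longlonglongrightarrow> sqrt 0"
    by (rule tendsto_real_sqrt)
  then have "(\<lambda>m. norm ((\<Sum>k<m. ell2_coeff x k *\<^sub>C basis_vec k) - x)) \<longlonglongrightarrow> 0"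
    by (simp add: norm_minus_commute)
  then show ?thesis
    unfolding sums_def by (simp add: LIM_zero_iff tendsto_norm_zero_iff)
qed

lemma bounded_clinear_eqI:
  fixes S T :: "ell2 \<Rightarrow> 'a::complex_hilbert"
  assumes "bounded_clinear S" "bounded_clinear T" "\<And>n. S (basis_vec n) = T (basis_vec n)"
  shows "S = T"
proof
  fix x
  have S: "(\<lambda>k. S (ell2_coeff x k *\<^sub>C basis_vec k)) sums S x"
    by (rule bounded_linear.sums[OF _ basis_vec_sums]) (use assms(1) in \<open>simp add: bounded_clinear_def\<close>)
  have T: "(\<lambda>k. T (ell2_coeff x k *\<^sub>C basis_vec k)) sums T x"
    by (rule bounded_linear.sums[OF _ basis_vec_sums]) (use assms(2) in \<open>simp add: bounded_clinear_def\<close>)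
  have "(\<lambda>k. S (ell2_coeff x k *\<^sub>C basis_vec k)) = (\<lambda>k. T (ell2_coeff x k *\<^sub>C basis_vec k))"
    using assms by (simp add: bounded_clinear_def)
  with S T show "S x = T x" by (simp add: sums_unique2)
qed

lemma weighted_shift_unique:
  assumes "bounded (range \<alpha>)"
  shows "T = weighted_shift \<alpha> \<longleftrightarrow>
    bounded_clinear T \<and> (\<forall>n. T (basis_vec n) = complex_of_real (\<alpha> n) *\<^sub>C basis_vec (Suc n))"
  using bounded_clinear_eqI[of T "weighted_shift \<alpha>"] bounded_clinear_weighted_shift[OF assms]
    weighted_shift_basis_vec[OF assms] by auto

definition is_weighted_shift :: "(ell2 \<Rightarrow> ell2) \<Rightarrow> bool" where
  "is_weighted_shift T \<longleftrightarrow>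
     (\<exists>\<beta>. (\<forall>n. 0 < \<beta> n) \<and> bounded (range \<beta>) \<and> T = weighted_shift \<beta>)"

end

theory Submission
  imports Defs
begin

text \<open>
  If \<open>T\<close> is subnormal with normal extension \<open>N\<close>, then after rescaling to \<open>\<parallel>N\<parallel> \<le> 1\<close> the moments
  \<open>\<parallel>T\<^sup>n x\<parallel>\<^sup>2 = \<langle>A\<^sup>n x, x\<rangle>\<close>, where \<open>A = N\<^sup>* N\<close>, form a completely monotone sequence, since their
  \<open>k\<close>-th backward differences are \<open>\<langle>A\<^sup>n (1 - A)\<^sup>k x, x\<rangle> \<ge> 0\<close>. For a completely monotone sequence
  the \<open>k\<close>-th differences at a fixed index \<open>n \<ge> 1\<close> telescope to a convergent series over \<open>k\<close>, so they
  tend to \<open>0\<close>; hence its value at \<open>n \<ge> 1\<close> is determined by its values at larger indices. If two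
  subnormal shifts have the same weights beyond \<open>n\<close>, their moments beyond \<open>n\<close> are proportional,
  hence so are those at \<open>n\<close>, and the weights at \<open>n\<close> agree. Index \<open>0\<close> is the exception because
  a point mass at \<open>0\<close> is seen by the zeroth moment only. No representing measure is needed.
\<close>

section \<open>Completely monotone sequences\<close>

text \<open>The sign is chosen so that \<open>f n = t ^ n\<close> gives t^n (1 - t)^k, which is
  nonnegative for t in [0,1].\<close>

fun fdiff :: "nat \<Rightarrow> (nat \<Rightarrow> real) \<Rightarrow> nat \<Rightarrow> real" where
  "fdiff 0 f n = f n"
| "fdiff (Suc k) f n = fdiff k f n - fdiff k f (Suc n)"

definition completely_monotone :: "(nat \<Rightarrow> real) \<Rightarrow> bool" where
  "completely_monotone f \<longleftrightarrow> (\<forall>k n. 0 \<le> fdiff k f n)"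

lemma fdiff_lincomb:
  "fdiff k (\<lambda>n. f n - c * g n) n = fdiff k f n - c * fdiff k g n"
  by (induction k arbitrary: n) (simp_all add: right_diff_distrib)

text \<open>In the expansion of \<open>fdiff k f n\<close> the value \<open>f n\<close> has
  coefficient 1, and all other values have index above n.\<close>

lemma fdiff_eq_self:
  assumes "\<And>m. n < m \<Longrightarrow> f m = 0"
  shows "fdiff k f n = f n"
proof -
  have tail: "fdiff k f m = 0" if "n < m" for k m
    using that by (induction k arbitrary: m) (simp_all add: assms)
  show ?thesis
    by (induction k) (simp_all add: tail)
qed

text \<open>The telescoping takes place at the preceding index, hence the bound on n. At index 0 the
  limit can fail: for the sequence 1, 0, 0, ... every difference at 0 is 1.\<close>

lemma fdiff_tendsto_zero:
  assumes "completely_monotone f" and "1 \<le> n"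
  shows "(\<lambda>k. fdiff k f n) \<longlonglongrightarrow> 0"
proof -
  obtain m where m: "n = Suc m"
    using assms(2) by (cases n) auto
  have nonneg: "0 \<le> fdiff k f i" for k i
    using assms(1) by (simp add: completely_monotone_def)
  have "(\<Sum>k<j. fdiff k f n) = f m - fdiff j f m" for j
    by (induction j) (simp_all add: m)
  then have "(\<Sum>k<j. fdiff k f n) \<le> f m" for j
    using nonneg[of j m] by simp
  then have "summable (\<lambda>k. fdiff k f n)"
    using nonneg by (intro summableI_nonneg_bounded)
  then show ?thesis
    by (rule summable_LIMSEQ_zero)
qed

text \<open>The differences of f - c g at n tend to 0 by linearity, yet all equal its value at n
  because it vanishes beyond n.\<close>

lemma completely_monotone_proportional:
  assumes "completely_monotone f" "completely_monotone g" and "1 \<le> n"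
    and "\<And>m. n < m \<Longrightarrow> f m = c * g m"
  shows "f n = c * g n"
proof -
  have "(\<lambda>k. fdiff k f n - c * fdiff k g n) \<longlonglongrightarrow> 0 - c * 0"
    using assms by (intro tendsto_intros fdiff_tendsto_zero)
  moreover have "fdiff k f n - c * fdiff k g n = f n - c * g n" for k
    unfolding fdiff_lincomb[symmetric] by (rule fdiff_eq_self) (simp add: assms(4))
  ultimately show ?thesis
    by (simp add: LIMSEQ_const_iff)
qed

section \<open>Moments of subnormal operators\<close>

lemma cinner_diff_left:
  "cinner (x - y) (z::'a::complex_hilbert) = cinner x z - cinner y z"
  using cinner_add_left[of "x - y" y z] by simp

lemma cinner_diff_right:
  "cinner (z::'a::complex_hilbert) (x - y) = cinner z x - cinner z y"
  using cinner_diff_left[of x y z, THEN arg_cong[where f = cnj]]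
  by (simp add: cinner_commute[symmetric])

lemma cinner_scaleR_left:
  "cinner (r *\<^sub>R x) (y::'a::complex_hilbert) = of_real r * cinner x y"
  by (simp add: scaleR_scaleC cinner_scaleC_left)

lemma cinner_scaleR_right:
  "cinner (x::'a::complex_hilbert) (r *\<^sub>R y) = of_real r * cinner x y"
  using cinner_scaleR_left[of r y x, THEN arg_cong[where f = cnj]]
  by (simp add: cinner_commute[symmetric])

lemma is_adjoint_sym:
  assumes "is_adjoint T S"
  shows "cinner (S y) x = cinner y (T x)"
proof -
  have "cnj (cinner x (S y)) = cnj (cinner (T x) y)"
    using assms by (simp add: is_adjoint_def)
  then show ?thesis
    by (simp only: cinner_commute[symmetric])
qed

lemma normal_operator_moments_completely_monotone:
  fixes N :: "'a::complex_hilbert \<Rightarrow> 'a"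
  assumes "normal_operator N" and "0 \<le> s"
    and contraction: "\<And>x. s * (norm (N x))\<^sup>2 \<le> (norm x)\<^sup>2"
  shows "completely_monotone (\<lambda>n. s ^ n * (norm ((N ^^ n) v))\<^sup>2)"
proof -
  obtain M where M: "bounded_clinear M" "is_adjoint N M" and "N \<circ> M = M \<circ> N"
    using assms(1) by (auto simp: normal_operator_def)
  then have NM: "N (M x) = M (N x)" for x
    by (metis comp_apply)
  have lM: "linear M"
    using M(1) by (simp add: bounded_clinear_def bounded_linear.linear)
  have adj: "cinner (N x) y = cinner x (M y)" and adj': "cinner (M x) y = cinner x (N y)" for x y
    using M(2) is_adjoint_sym[OF M(2)] by (auto simp: is_adjoint_def)
  define B where "B x = x - s *\<^sub>R M (N x)" for x
  \<comment> \<open>Normality enters here: B is 1 - s N*N, and M commutes with it because M commutes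
    with N.\<close>
  have MB: "M (B x) = B (M x)" for x
    by (simp add: B_def NM linear_diff[OF lM] linear_cmul[OF lM])
  then have MBk: "M ((B ^^ k) x) = (B ^^ k) (M x)" for k x
    by (induction k) simp_all
  have B_self_adjoint: "cinner (B x) y = cinner x (B y)" for x y
    by (simp add: B_def cinner_diff_left cinner_diff_right cinner_scaleR_left
        cinner_scaleR_right adj adj')
  have norm_B: "cinner (B x) x = of_real ((norm x)\<^sup>2 - s * (norm (N x))\<^sup>2)" for x
    by (simp add: B_def cinner_diff_left cinner_scaleR_left adj' cinner_self)
  define q where "q k x = Re (cinner ((B ^^ k) x) x)" for k x
  have Bk_comm: "(B ^^ k) (B x) = B ((B ^^ k) x)" for k x
    by (simp add: funpow_swap1)
  \<comment> \<open>Induction in steps of two replaces a square root of B: self-adjointness moves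
    one factor to the other side. The base cases are the norm and the contraction bound.\<close>
  have q_nonneg: "0 \<le> q k x" for k x
  proof (induction k arbitrary: x rule: nat_less_induct)
    case (1 k)
    consider "k = 0" | "k = 1" | j where "k = Suc (Suc j)"
      by (metis One_nat_def not0_implies_Suc)
    then show ?case
    proof cases
      case 3
      then have "q k x = q j (B x)"
        by (simp add: q_def Bk_comm B_self_adjoint)
      with 3 1 show ?thesis by simp
    qed (use contraction[of x] in \<open>simp_all add: q_def cinner_self norm_B\<close>)
  qed
  have Bk_diff: "(B ^^ k) (x - s *\<^sub>R y) = (B ^^ k) x - s *\<^sub>R (B ^^ k) y" for k x y
  proof -
    have lN: "linear N"
      using assms(1) by (simp add: normal_operator_def bounded_clinear_def bounded_linear.linear)
    have "B (x - s *\<^sub>R y) = B x - s *\<^sub>R B y" for x y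
      by (simp add: B_def linear_diff[OF lN] linear_cmul[OF lN] linear_diff[OF lM]
          linear_cmul[OF lM] algebra_simps)
    then show ?thesis
      by (induction k) simp_all
  qed
  \<comment> \<open>The innermost factor B is expanded; its M is pulled out through the remaining
    factors and becomes N on the right of the inner product.\<close>
  have q_Suc: "q (Suc k) x = q k x - s * q k (N x)" for k x
  proof -
    have "(B ^^ Suc k) x = (B ^^ k) (x - s *\<^sub>R M (N x))"
      by (simp add: Bk_comm[symmetric]) (simp add: B_def)
    also have "\<dots> = (B ^^ k) x - s *\<^sub>R M ((B ^^ k) (N x))"
      by (simp add: Bk_diff MBk)
    finally show ?thesis
      by (simp add: q_def cinner_diff_left cinner_scaleR_left adj')
  qed
  have "fdiff k (\<lambda>n. s ^ n * (norm ((N ^^ n) v))\<^sup>2) n = s ^ n * q k ((N ^^ n) v)" for k n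
  proof (induction k arbitrary: n)
    case 0
    show ?case by (simp add: q_def cinner_self)
  next
    case (Suc k)
    then show ?case by (simp add: q_Suc algebra_simps)
  qed
  then show ?thesis
    using q_nonneg assms(2) by (simp add: completely_monotone_def)
qed

text \<open>The isometry V carries orbits of T to orbits of N without changing norms. All small s
  are covered so that two operators can be treated at one common scale.\<close>

lemma subnormal_in_moments_completely_monotone:
  assumes "subnormal_in TYPE('k::complex_hilbert) T"
  obtains r where "0 < r"
    and "\<And>s x. \<lbrakk>0 \<le> s; s \<le> r\<rbrakk> \<Longrightarrow> completely_monotone (\<lambda>n. s ^ n * (norm ((T ^^ n) x))\<^sup>2)"
proof -
  obtain V :: "_ \<Rightarrow> 'k" and N where V: "\<And>x y. cinner (V x) (V y) = cinner x y"
    and N: "normal_operator N" and NV: "\<And>x. N (V x) = V (T x)"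
    using assms unfolding subnormal_in_def by blast
  have "complex_of_real ((norm (V x))\<^sup>2) = complex_of_real ((norm x)\<^sup>2)" for x
    by (metis V cinner_self)
  then have normV: "(norm (V x))\<^sup>2 = (norm x)\<^sup>2" for x
    by (simp only: of_real_eq_iff)
  have "bounded_linear N"
    using N by (simp add: normal_operator_def bounded_clinear_def)
  then obtain K where K: "0 < K" "\<And>x. norm (N x) \<le> norm x * K"
    using bounded_linear.pos_bounded by blast
  have NVn: "(N ^^ n) (V x) = V ((T ^^ n) x)" for n x
    by (induction n) (simp_all add: NV)
  show ?thesis
  \<comment> \<open>With this threshold, N scaled by the square root of s is a contraction.\<close>
  proof (rule that[of "inverse (K\<^sup>2)"])
    show "0 < inverse (K\<^sup>2)"
      using K(1) by simp
    fix s x assume s: "0 \<le> s" "s \<le> inverse (K\<^sup>2)"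
    have "s * (norm (N y))\<^sup>2 \<le> (norm y)\<^sup>2" for y
    proof -
      have "s * (norm (N y))\<^sup>2 \<le> inverse (K\<^sup>2) * (norm y * K)\<^sup>2"
        using s K by (intro mult_mono power_mono) auto
      also have "\<dots> = (norm y)\<^sup>2"
        using K(1) by (simp add: power_mult_distrib)
      finally show ?thesis .
    qed
    from normal_operator_moments_completely_monotone[OF N s(1) this, of "V x"]
    show "completely_monotone (\<lambda>n. s ^ n * (norm ((T ^^ n) x))\<^sup>2)"
      by (simp add: NVn normV)
  qed
qed

section \<open>Finite perturbations of weighted shifts\<close>

lemma norm_scaleC: "norm (c *\<^sub>C (x::'a::complex_hilbert)) = cmod c * norm x"
proof -
  have "complex_of_real ((norm (c *\<^sub>C x))\<^sup>2) = c * cnj c * cinner x x"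
    using cinner_commute[of x "c *\<^sub>C x"] cinner_commute[of x x]
    by (simp only: cinner_self[symmetric] cinner_scaleC_left complex_cnj_mult mult.assoc)
  also have "\<dots> = complex_of_real ((cmod c * norm x)\<^sup>2)"
    by (simp add: cinner_self complex_norm_square[symmetric] power_mult_distrib)
  finally have "(norm (c *\<^sub>C x))\<^sup>2 = (cmod c * norm x)\<^sup>2"
    by (simp only: of_real_eq_iff)
  then show ?thesis
    by simp
qed

lemma cinner_basis_vec: "cinner x (basis_vec n) = ell2_coeff x n"
proof -
  have "(\<Sum>k. ell2_coeff x k * cnj (ell2_coeff (basis_vec n) k))
      = (\<Sum>k\<in>{n}. ell2_coeff x k * cnj (ell2_coeff (basis_vec n) k))"
    by (rule suminf_finite) (simp_all add: basis_vec.rep_eq)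
  then show ?thesis
    by (simp add: cinner_ell2_def basis_vec.rep_eq)
qed

lemma norm_basis_vec: "norm (basis_vec n) = 1"
proof -
  have "complex_of_real ((norm (basis_vec n))\<^sup>2) = complex_of_real 1"
    by (simp only: cinner_self[symmetric] cinner_basis_vec) (simp add: basis_vec.rep_eq)
  then have "(norm (basis_vec n))\<^sup>2 = 1"
    by (simp only: of_real_eq_iff)
  then show ?thesis
    by (simp add: power2_eq_1_iff) (metis norm_ge_zero not_one_le_zero neg_0_le_iff_le)
qed

lemma inj_basis_vec: "inj basis_vec"
  by (rule injI) (metis basis_vec.rep_eq zero_neq_one)

lemma independent_range_basis_vec: "complex_hilbert.independent (range basis_vec)"
proof
  assume "complex_hilbert.dependent (range basis_vec)"
  then obtain t u v where t: "finite t" "t \<subseteq> range basis_vec"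
    and sum0: "(\<Sum>v\<in>t. u v *\<^sub>C v) = 0" and v: "v \<in> t" "u v \<noteq> 0"
    unfolding complex_hilbert.dependent_explicit by blast
  then obtain n where n: "v = basis_vec n"
    by blast
  have "u w * ell2_coeff w n = (if w = v then u v else 0)" if "w \<in> t" for w
  proof -
    obtain m where "w = basis_vec m"
      using \<open>w \<in> t\<close> t(2) by auto
    then show ?thesis
      using n injD[OF inj_basis_vec] by (auto simp: basis_vec.rep_eq)
  qed
  then have "ell2_coeff (\<Sum>w\<in>t. u w *\<^sub>C w) n = (\<Sum>w\<in>t. if w = v then u v else 0)"
    by (simp add: coeff_sum scaleC_ell2.rep_eq)
  also have "\<dots> = u v"
    using t v by simp
  finally show False
    using sum0 v by (simp add: zero_ell2.rep_eq)
qed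

section \<open>Moments of a weighted shift along the orbit of \<open>basis_vec 0\<close>\<close>

lemma weighted_shift_funpow_basis_vec:
  assumes "bounded (range \<alpha>)"
  shows "(weighted_shift \<alpha> ^^ n) (basis_vec 0) = complex_of_real (\<Prod>i<n. \<alpha> i) *\<^sub>C basis_vec n"
proof (induction n)
  case 0
  show ?case
    using scaleR_scaleC[of 1 "basis_vec 0"] by simp
next
  case (Suc n)
  have "weighted_shift \<alpha> (c *\<^sub>C x) = c *\<^sub>C weighted_shift \<alpha> x" for c x
    using bounded_clinear_weighted_shift[OF assms] by (simp add: bounded_clinear_def)
  with Suc show ?case
    by (simp add: weighted_shift_basis_vec[OF assms] scaleC_scaleC)
qed

lemma norm_weighted_shift_funpow:
  assumes "bounded (range \<alpha>)"
  shows "(norm ((weighted_shift \<alpha> ^^ n) (basis_vec 0)))\<^sup>2 = (\<Prod>i<n. \<alpha> i)\<^sup>2"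
  by (simp only: weighted_shift_funpow_basis_vec[OF assms] norm_scaleC norm_basis_vec
      norm_of_real mult_1_right power2_abs)

lemma weighted_shift_moments_completely_monotone:
  assumes "bounded (range \<alpha>)" and "subnormal_in TYPE('k::complex_hilbert) (weighted_shift \<alpha>)"
  obtains r where "0 < r"
    and "\<And>s. \<lbrakk>0 \<le> s; s \<le> r\<rbrakk> \<Longrightarrow> completely_monotone (\<lambda>n. s ^ n * (\<Prod>i<n. \<alpha> i)\<^sup>2)"
proof (rule subnormal_in_moments_completely_monotone[OF assms(2)])
  fix r :: real
  assume "0 < r"
    and "\<And>s x. \<lbrakk>0 \<le> s; s \<le> r\<rbrakk>
      \<Longrightarrow> completely_monotone (\<lambda>n. s ^ n * (norm ((weighted_shift \<alpha> ^^ n) x))\<^sup>2)"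
  from that[OF this(1)] this(2)[of _ "basis_vec 0"] show thesis
    by (simp only: norm_weighted_shift_funpow[OF assms(1)])
qed

section \<open>Comparison of two subnormal shifts\<close>

lemma subnormal_weights_agree_step:
  fixes \<alpha> \<beta> :: "nat \<Rightarrow> real"
  assumes \<alpha>: "\<And>n. 0 < \<alpha> n" "bounded (range \<alpha>)" "subnormal_in TYPE('k::complex_hilbert) (weighted_shift \<alpha>)"
    and \<beta>: "\<And>n. 0 < \<beta> n" "bounded (range \<beta>)" "subnormal_in TYPE('l::complex_hilbert) (weighted_shift \<beta>)"
    and n: "1 \<le> n" and agree: "\<And>m. n < m \<Longrightarrow> \<beta> m = \<alpha> m"
  shows "\<beta> n = \<alpha> n"
proof -
  define a b where "a m = (\<Prod>i<m. \<alpha> i)\<^sup>2" and "b m = (\<Prod>i<m. \<beta> i)\<^sup>2" for m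
  have a_pos: "0 < a m" and b_pos: "0 < b m" for m
    using \<alpha>(1) \<beta>(1) by (simp_all only: a_def b_def prod_pos zero_less_power)
  \<comment> \<open>Weights with index above n agree, so from moment \<open>Suc n\<close> on both
    sequences grow by the same factors and keep this ratio.\<close>
  define c where "c = b (Suc n) / a (Suc n)"
  have tail: "b (Suc n + j) = c * a (Suc n + j)" for j
  proof (induction j)
    case 0
    show ?case
      using a_pos[of "Suc n"] by (simp add: c_def)
  next
    case (Suc j)
    then show ?case
      by (simp add: a_def b_def power_mult_distrib agree)
  qed
  obtain r where r: "0 < r"
    "\<And>s. \<lbrakk>0 \<le> s; s \<le> r\<rbrakk> \<Longrightarrow> completely_monotone (\<lambda>n. s ^ n * a n)"
    using weighted_shift_moments_completely_monotone[OF \<alpha>(2,3)] unfolding a_def by blast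
  obtain r' where r': "0 < r'"
    "\<And>s. \<lbrakk>0 \<le> s; s \<le> r'\<rbrakk> \<Longrightarrow> completely_monotone (\<lambda>n. s ^ n * b n)"
    using weighted_shift_moments_completely_monotone[OF \<beta>(2,3)] unfolding b_def by blast
  define s where "s = min r r'"
  have s: "0 < s" "s \<le> r" "s \<le> r'"
    using r(1) r'(1) by (auto simp: s_def)
  have "s ^ n * b n = c * (s ^ n * a n)"
  proof (rule completely_monotone_proportional[where f = "\<lambda>n. s ^ n * b n" and g = "\<lambda>n. s ^ n * a n"])
    fix m assume "n < m"
    then show "s ^ m * b m = c * (s ^ m * a m)"
      using tail[of "m - Suc n"] by simp
  qed (use r(2) r'(2) s n in auto)
  \<comment> \<open>Equal ratios at n and \<open>Suc n\<close> mean equal growth factors between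
    these moments, and those factors are the squared weights at n.\<close>
  then have "b n * a (Suc n) = b (Suc n) * a n"
    using s(1) a_pos[of "Suc n"] by (simp add: c_def field_simps)
  then have "b n * a n * (\<alpha> n)\<^sup>2 = b n * a n * (\<beta> n)\<^sup>2"
    by (simp add: a_def b_def power_mult_distrib mult_ac)
  then have "(\<alpha> n)\<^sup>2 = (\<beta> n)\<^sup>2"
    using a_pos[of n] b_pos[of n] by simp
  then show ?thesis
    using \<alpha>(1)[of n] \<beta>(1)[of n] by (simp add: power2_eq_iff_nonneg less_imp_le)
qed

text \<open>Beyond the largest positive index of disagreement the weights agree, so the one-step
  result applies there and gives a contradiction.\<close>

lemma subnormal_weights_agree:
  fixes \<alpha> \<beta> :: "nat \<Rightarrow> real"
  assumes \<alpha>: "\<And>n. 0 < \<alpha> n" "bounded (range \<alpha>)" "subnormal_in TYPE('k::complex_hilbert) (weighted_shift \<alpha>)"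
    and \<beta>: "\<And>n. 0 < \<beta> n" "bounded (range \<beta>)" "subnormal_in TYPE('l::complex_hilbert) (weighted_shift \<beta>)"
    and fin: "finite {n. \<beta> n \<noteq> \<alpha> n}" and "1 \<le> n"
  shows "\<beta> n = \<alpha> n"
proof (rule ccontr)
  assume "\<beta> n \<noteq> \<alpha> n"
  define D where "D = {m. 1 \<le> m \<and> \<beta> m \<noteq> \<alpha> m}"
  have D: "finite D" "D \<noteq> {}"
    using fin \<open>\<beta> n \<noteq> \<alpha> n\<close> \<open>1 \<le> n\<close> by (auto simp: D_def)
  have "Max D \<in> D"
    using D by (rule Max_in)
  then have "1 \<le> Max D" and "\<beta> (Max D) \<noteq> \<alpha> (Max D)"
    by (simp_all add: D_def)
  moreover have "\<beta> m = \<alpha> m" if "Max D < m" for m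
    using Max_ge[OF D(1), of m] that by (fastforce simp: D_def)
  ultimately show False
    using subnormal_weights_agree_step[OF \<alpha> \<beta>] by blast
qed

text \<open>Each nonzero \<open>d n\<close> puts \<open>basis_vec (Suc n)\<close> into one span of
  finitely many vectors, and these basis vectors are independent.\<close>

lemma finite_rank_weights_differ_finite:
  assumes "finite_rank F"
    and F: "\<And>n. F (basis_vec n) = complex_of_real (d n) *\<^sub>C basis_vec (Suc n)"
  shows "finite {n. d n \<noteq> 0}"
proof -
  obtain C where C: "finite C" "range F \<subseteq> cspan C"
    using assms(1) by (auto simp: finite_rank_def)
  have "basis_vec (Suc n) \<in> cspan C" if "d n \<noteq> 0" for n
  proof -
    have "complex_of_real (inverse (d n)) *\<^sub>C F (basis_vec n) \<in> cspan C"
      using C(2) by (intro complex_hilbert.span_scale) auto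
    then show ?thesis
      using that scaleR_scaleC[of 1 "basis_vec (Suc n)"] by (simp add: F scaleC_scaleC)
  qed
  then have "(\<lambda>n. basis_vec (Suc n)) ` {n. d n \<noteq> 0} \<subseteq> cspan C"
    by blast
  moreover have "complex_hilbert.independent ((\<lambda>n. basis_vec (Suc n)) ` {n. d n \<noteq> 0})"
    by (rule complex_hilbert.independent_mono[OF independent_range_basis_vec]) auto
  ultimately have "finite ((\<lambda>n. basis_vec (Suc n)) ` {n. d n \<noteq> 0})"
    using complex_hilbert.independent_span_bound[OF C(1)] by blast
  moreover have "inj_on (\<lambda>n. basis_vec (Suc n)) {n. d n \<noteq> 0}"
    using inj_basis_vec by (auto simp: inj_on_def)
  ultimately show ?thesis
    by (rule finite_imageD)
qed

theorem theorem2p1: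
  fixes \<alpha> :: "nat \<Rightarrow> real"
  assumes "\<forall>n. 0 < \<alpha> n" and "bounded (range \<alpha>)"
    and "subnormal_in TYPE('k::complex_hilbert) (weighted_shift \<alpha>)"
  shows "(\<nexists>F :: ell2 \<Rightarrow> ell2.
            finite_rank F \<and> F \<noteq> (\<lambda>x. 0) \<and>
            \<not> (\<exists>c. F = (\<lambda>x. (c * cinner x (basis_vec 0)) *\<^sub>C basis_vec 1)) \<and>
            is_weighted_shift (\<lambda>x. weighted_shift \<alpha> x + F x) \<and>
            subnormal_in TYPE('l::complex_hilbert) (\<lambda>x. weighted_shift \<alpha> x + F x))
         \<and> (\<forall>\<alpha>' :: nat \<Rightarrow> real.
              (\<forall>n. 0 < \<alpha>' n) \<and> \<alpha>' 0 = \<alpha> 0 \<and> finite {n. \<alpha>' n \<noteq> \<alpha> n} \<and> \<alpha>' \<noteq> \<alpha>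
              \<longrightarrow> \<not> subnormal_in TYPE('l) (weighted_shift \<alpha>'))"
proof (intro conjI notI allI impI; (elim exE conjE)?)
  fix F :: "ell2 \<Rightarrow> ell2"
  assume F: "finite_rank F" and no_form: "\<nexists>c. F = (\<lambda>x. (c * cinner x (basis_vec 0)) *\<^sub>C basis_vec 1)"
    and "is_weighted_shift (\<lambda>x. weighted_shift \<alpha> x + F x)"
    and sub: "subnormal_in TYPE('l) (\<lambda>x. weighted_shift \<alpha> x + F x)"
  then obtain \<beta> where \<beta>: "\<And>n. 0 < \<beta> n" "bounded (range \<beta>)"
    and eq: "(\<lambda>x. weighted_shift \<alpha> x + F x) = weighted_shift \<beta>"
    unfolding is_weighted_shift_def by blast
  have F_eq: "F x = weighted_shift \<beta> x - weighted_shift \<alpha> x" for x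
    using fun_cong[OF eq, of x] by (simp add: algebra_simps)
  have "F (basis_vec n) = complex_of_real (\<beta> n - \<alpha> n) *\<^sub>C basis_vec (Suc n)" for n
    by (simp add: F_eq weighted_shift_basis_vec assms(2) \<beta>(2) complex_hilbert.scale_left_diff_distrib)
  from finite_rank_weights_differ_finite[OF F this]
  have "finite {n. \<beta> n \<noteq> \<alpha> n}"
    by simp
  then have agree: "\<beta> n = \<alpha> n" if "1 \<le> n" for n
    using subnormal_weights_agree[of \<alpha> \<beta> n] assms \<beta> sub eq that by simp
  \<comment> \<open>Only the weight at 0 can still differ, so \<open>F x\<close> has no coefficient
    outside index 1.\<close>
  have "F x = (complex_of_real (\<beta> 0 - \<alpha> 0) * cinner x (basis_vec 0)) *\<^sub>C basis_vec 1" for x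
    using agree
    by (auto simp: ell2_coeff_inject[symmetric] fun_eq_iff F_eq minus_ell2.rep_eq scaleC_ell2.rep_eq
        coeff_weighted_shift assms(2) \<beta>(2) cinner_basis_vec basis_vec.rep_eq algebra_simps
        split: nat.split)
  with no_form show False
    by blast
next
  fix \<alpha>' :: "nat \<Rightarrow> real"
  assume pos: "\<forall>n. 0 < \<alpha>' n" and zero: "\<alpha>' 0 = \<alpha> 0" and fin: "finite {n. \<alpha>' n \<noteq> \<alpha> n}"
    and "\<alpha>' \<noteq> \<alpha>" and sub: "subnormal_in TYPE('l) (weighted_shift \<alpha>')"
  \<comment> \<open>Boundedness of \<alpha>' is inherited from \<alpha>, since at most finitely many
    values are new.\<close>
  have "range \<alpha>' \<subseteq> range \<alpha> \<union> \<alpha>' ` {n. \<alpha>' n \<noteq> \<alpha> n}"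
    by fastforce
  then have "bounded (range \<alpha>')"
    using assms(2) fin by (meson bounded_Un bounded_subset finite_imageI finite_imp_bounded)
  then have "\<alpha>' n = \<alpha> n" for n
    using subnormal_weights_agree[of \<alpha> \<alpha>' n] assms pos sub fin zero by (cases n) auto
  with \<open>\<alpha>' \<noteq> \<alpha>\<close> show False
    by blast
qed

end
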